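(* Let $(\mathcal{Q},\vartheta)$ be a minimal almost periodic flow and let $\psi$ be a cocycle in $\mathbb{E}$ over $(\mathcal{Q},\vartheta)$. Suppose there is a family of symmetric operators $P(q)\in\mathcal{L}(\mathbb{E};\mathbb{E}^* )$, $q\in\mathcal{Q}$, depending continuously on $q$ in operator norm, with $\sup_q\|P(q)\|<\infty$ and such that $V_q(v):=\langle v,P(q)v\rangle>0$ for all $v\in\mathbb{E}\setminus\{0\}$ (i.e. the negative subspaces have dimension $j=0$), with respect to which $\psi$ satisfies the squeezing property with continuous $\nu_0(\cdot)$ and $\nu^->0$. Suppose also that $\psi$ satisfies asymptotic compactness with exponent $\gamma^+=\nu^+$ and the uniform Lipschitz property, and that for some $q_0\in\mathcal{Q}$ there exists $v_0\in\mathbb{E}$ such that the trajectory $\mathbb{R}_+\ni t\mapsto\psi^t(q_0,v_0)\in\mathbb{E}$ lies in a compact set. Then for every $q\in\mathcal{Q}$ there exists a unique almost periodic (complete) trajectory $v_q^*(\cdot)$ over $q$, it depends continuously on $q$ (i.e. $q\mapsto v_q^*(0)$ is continuous), and it is exponentially stable in the sense that there is a constant $M>0$ such that for any $v_0\in\mathbb{E}$, $q\in\mathcal{Q}$ and $t\ge0$ $$\|\psi^t(q,v_0)-\psi^t(q,v^*_q(0))\|_{\mathbb{E}}\le M\cdot e^{-\nu(t;q)}\cdot\|v_0-v_q^*(0)\|_{\mathbb{E}}.$$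
   Context: $\mathbb{R}_+=[0,\infty)$. $\mathcal{Q}$ is a compact metric space with a flow $\vartheta=\{\vartheta^t\}_{t\in\mathbb{R}}$ (jointly continuous in $(t,q)$) which is minimal (every orbit is dense) and almost periodic in the sense of Bohr (for every $\varepsilon>0$ the set of $\tau\in\mathbb{R}$ with $\sup_q d(\vartheta^\tau(q),q)<\varepsilon$ is relatively dense in $\mathbb{R}$). $\mathbb{E}$ is a real or complex Banach space continuously embedded in a Hilbert space $\mathbb{H}$ with norm $|\cdot|_{\mathbb{H}}$. A cocycle $\psi$ in $\mathbb{E}$ over $(\mathcal{Q},\vartheta)$ is a family of maps $\psi^t(q,\cdot)\colon\mathbb{E}\to\mathbb{E}$, $t\ge0$, $q\in\mathcal{Q}$, with $\psi^0(q,v)=v$, $\psi^{t+s}(q,v)=\psi^t(\vartheta^s(q),\psi^s(q,v))$ and $(t,q,v)\mapsto\psi^t(q,v)$ continuous. $P\in\mathcal{L}(\mathbb{E};\mathbb{E}^* )$ is symmetric if $\langle v_1,Pv_2\rangle=\overline{\langle v_2,Pv_1\rangle}$ (in the complex case $\mathbb{E}^*$ consists of conjugate-linear functionals). Squeezing property: there are constants $\nu^-<\nu^+$, $\delta_P>0$, $\tau_P\ge0$ and a Borel function $\nu_0\colon\mathcal{Q}\to\mathbb{R}_+$ with $\nu^-\le\nu_0(\cdot)\le\nu^+$ such that with $\nu(t;q)=\int_0^t\nu_0(\vartheta^s(q))ds$ $$e^{2\nu(r;q)}V_{\vartheta^r(q)}(\psi^r(q,v_1)-\psi^r(q,v_2))-e^{2\nu(l;q)}V_{\vartheta^l(q)}(\psi^l(q,v_1)-\psi^l(q,v_2))\le-\delta_P\int_l^re^{2\nu(s;q)}|\psi^s(q,v_1)-\psi^s(q,v_2)|^2_{\mathbb{H}}ds$$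 for all $q\in\mathcal{Q}$, $v_1,v_2\in\mathbb{E}$ and $r,l\ge0$ with $r-l\ge\tau_P$. Uniform Lipschitz property: there is $\tau_S\ge0$ such that for every $T>0$ there is $L_T>0$ with $\|\psi^t(q,v_1)-\psi^t(q,v_2)\|_{\mathbb{E}}\le L_T|v_1-v_2|_{\mathbb{H}}$ for $t\in[\tau_S,\tau_S+T]$ and $\|\psi^t(q,v_1)-\psi^t(q,v_2)\|_{\mathbb{E}}\le L_T\|v_1-v_2\|_{\mathbb{E}}$ for $t\in[0,T]$, for all $q,v_1,v_2$. Asymptotic compactness with exponent $\gamma^+$: for every compact $\mathcal{C}\subset\mathcal{Q}$ there is $\gamma_0\colon\mathbb{R}_+\to\mathbb{R}_+$ with $\gamma_0(t)\to0$ as $t\to+\infty$ and $\alpha_K(\psi^t(\mathcal{C},\mathcal{B}))\le\gamma_0(t)e^{-\gamma^+t}\alpha_K(\mathcal{B})$ for all $t\ge0$ and bounded $\mathcal{B}\subset\mathbb{E}$, where $\alpha_K$ is the Kuratowski measure of noncompactness in $\mathbb{E}$. A complete trajectory over $q$ is a continuous $v\colon\mathbb{R}\to\mathbb{E}$ with $v(t+s)=\psi^t(\vartheta^s(q),v(s))$ for $t\ge0$, $s\in\mathbb{R}$; it is almost periodic if it is a Bohr almost periodic $\mathbb{E}$-valued function. *)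

theory Defs
  imports "HOL-Analysis.Analysis"
begin

section \<open>Real or complex scalars\<close>

text \<open>
  Up to isomorphism this class has exactly the two instances \<^typ>\<open>real\<close> and \<^typ>\<open>complex\<close>
  (see \<open>real_or_complex_cases\<close> below), so a type variable of this class is
  ``the real or complex field''.
\<close>

class real_or_complex = real_normed_field +
  fixes conjug :: "'a \<Rightarrow> 'a"
    and real_part :: "'a \<Rightarrow> real"
  assumes conjug_add: "conjug (x + y) = conjug x + conjug y"
    and conjug_mult: "conjug (x * y) = conjug x * conjug y"
    and mult_conjug_scaleR: "x * conjug x = (norm x)\<^sup>2 *\<^sub>R 1"
    and real_part_scaleR: "(2 * real_part x) *\<^sub>R 1 = x + conjug x"

instantiation real :: real_or_complex
begin
definition conjug_real :: "real \<Rightarrow> real" where "conjug_real x = x"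
definition real_part_real :: "real \<Rightarrow> real" where "real_part_real x = x"
instance
  by standard (simp_all add: conjug_real_def real_part_real_def power2_eq_square)
end

instantiation complex :: real_or_complex
begin
definition conjug_complex :: "complex \<Rightarrow> complex" where "conjug_complex z = cnj z"
definition real_part_complex :: "complex \<Rightarrow> real" where "real_part_complex z = Re z"
instance
proof
  fix x y :: complex
  show "conjug (x + y) = conjug x + conjug y" "conjug (x * y) = conjug x * conjug y"
    by (simp_all add: conjug_complex_def)
  show "x * conjug x = (norm x)\<^sup>2 *\<^sub>R 1"
    by (simp only: conjug_complex_def complex_norm_square flip: of_real_def)
  show "(2 * real_part x) *\<^sub>R 1 = x + conjug x"
    by (simp add: conjug_complex_def real_part_complex_def complex_eq_iff)
qed
end

lemma mult_conjug: "x * conjug x = of_real ((norm x)\<^sup>2)" for x :: "'k::real_or_complex"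
  by (simp only: mult_conjug_scaleR of_real_def)

lemma of_real_real_part: "of_real (real_part x) = (x + conjug x) / 2"
  for x :: "'k::real_or_complex"
proof -
  have "2 * of_real (real_part x) = x + conjug x"
    using real_part_scaleR[of x] by (simp flip: of_real_def)
  then show ?thesis by (simp add: field_simps)
qed

lemma conjug_of_real: "conjug (of_real r :: 'k::real_or_complex) = of_real r"
proof (cases "r = 0")
  case True
  have "conjug (0 + 0 :: 'k) = conjug 0 + conjug 0"
    by (rule conjug_add)
  with True show ?thesis by simp
next
  case False
  have "of_real r * conjug (of_real r :: 'k) = of_real r * of_real r"
    by (simp add: mult_conjug power2_eq_square flip: of_real_mult)
  with False show ?thesis by simp
qed

lemma real_or_complex_cases:
  shows "(\<forall>z::'k::real_or_complex. z \<in> \<real> \<and> conjug z = z) \<or>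
         (\<exists>i::'k. i * i = -1 \<and> conjug i = - i \<and>
                  (\<forall>z. \<exists>a b. z = of_real a + of_real b * i))"
proof (cases "\<forall>z::'k. z \<in> \<real>")
  case True
  then show ?thesis by (metis Reals_cases conjug_of_real)
next
  case False
  have minus: "conjug (- x) = - conjug x" for x :: 'k
    using conjug_mult[of "-1" x] conjug_of_real[of "-1", where 'k='k] by simp
  have anti: "conjug (u - of_real (real_part u)) = - (u - of_real (real_part u))" for u :: 'k
  proof -
    have "conjug (u - of_real (real_part u)) = conjug u - of_real (real_part u)"
      using conjug_add[of u "- of_real (real_part u)"] by (simp add: minus conjug_of_real)
    then show ?thesis by (simp add: of_real_real_part field_simps)
  qed
  obtain z :: 'k where z: "z \<notin> \<real>" using False by blast
  define w where "w = z - of_real (real_part z)"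
  have w: "w \<noteq> 0" "conjug w = - w"
    using z anti[of z] by (auto simp: w_def) (metis Reals_of_real)
  have ww: "w * w = - of_real ((norm w)\<^sup>2)"
    using mult_conjug[of w] w(2) by (metis minus_minus mult_minus_right)
  define i where "i = w * of_real (inverse (norm w))"
  have i2: "i * i = -1"
  proof -
    have "i * i = (w * w) * of_real ((inverse (norm w))\<^sup>2)"
      by (simp add: i_def power2_eq_square)
    also have "\<dots> = - of_real ((norm w)\<^sup>2 * (inverse (norm w))\<^sup>2)"
      by (simp add: ww)
    also have "(norm w)\<^sup>2 * (inverse (norm w))\<^sup>2 = 1"
      using w(1) by (simp add: field_simps)
    finally show ?thesis by simp
  qed
  have ci: "conjug i = - i"
    by (simp add: i_def conjug_mult w(2) conjug_of_real del: of_real_inverse)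
  have "\<exists>a b. u = of_real a + of_real b * i" for u :: 'k
  proof -
    define x where "x = u - of_real (real_part u)"
    have "conjug (x * i) = x * i"
      using anti[of u] by (simp add: conjug_mult ci x_def flip: mult_minus_left)
    then have xi: "x * i = of_real (real_part (x * i))"
      using of_real_real_part[of "x * i"] by simp
    have "x = - (x * i) * i"
      by (simp add: mult.assoc i2)
    also have "\<dots> = of_real (- real_part (x * i)) * i"
      by (subst xi) simp
    finally have "u = of_real (real_part u) + of_real (- real_part (x * i)) * i"
      by (simp add: x_def algebra_simps)
    then show ?thesis by blast
  qed
  with i2 ci show ?thesis by blast
qed

section \<open>Spaces and operators\<close>

text \<open>
  A real normed space carrying a compatible multiplication by scalars of type \<open>'k\<close>.
  For \<open>'k = real\<close> this forces \<open>scale = scaleR\<close>; for \<open>'k = complex\<close> it is a complex normed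
  space, \<open>'e\<close> being its underlying real normed space.
\<close>

locale scalar_normed_space = vector_space scale
  for scale :: "'k::real_or_complex \<Rightarrow> 'e::real_normed_vector \<Rightarrow> 'e" +
  assumes scale_of_real: "scale (of_real r) x = r *\<^sub>R x"
    and norm_scale: "norm (scale a x) = norm a * norm x"

text \<open>Completeness of the Hilbert space comes from the type class \<^class>\<open>banach\<close>.\<close>

locale scalar_hilbert_space = scalar_normed_space scale
  for scale :: "'k::real_or_complex \<Rightarrow> 'h::banach \<Rightarrow> 'h" +
  fixes ip :: "'h \<Rightarrow> 'h \<Rightarrow> 'k"
  assumes ip_add: "ip (x + y) z = ip x z + ip y z"
    and ip_scale: "ip (scale a x) y = a * ip x y"
    and ip_conjug: "ip y x = conjug (ip x y)"
    and ip_self: "ip x x = of_real ((norm x)\<^sup>2)"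

definition continuous_embedding ::
    "('k::real_or_complex \<Rightarrow> 'e::real_normed_vector \<Rightarrow> 'e) \<Rightarrow>
     ('k \<Rightarrow> 'h::real_normed_vector \<Rightarrow> 'h) \<Rightarrow> ('e \<Rightarrow> 'h) \<Rightarrow> bool" where
  "continuous_embedding scaleE scaleH J \<longleftrightarrow>
     bounded_linear J \<and> (\<forall>a v. J (scaleE a v) = scaleH a (J v)) \<and> inj J"

text \<open>
  Elements of \<open>\<L>(E;E\<^sup>*)\<close>, with \<open>E\<^sup>*\<close> the conjugate-linear functionals, are represented as those
  real-linear bounded maps that respect the scalars; the operator norm is unaffected.
  The pairing \<open>\<langle>v, P w\<rangle>\<close> is \<open>P w v\<close>.
\<close>

definition operator_to_dual ::
    "('k::real_or_complex \<Rightarrow> 'e::real_normed_vector \<Rightarrow> 'e) \<Rightarrow> ('e \<Rightarrow>\<^sub>L 'e \<Rightarrow>\<^sub>L 'k) \<Rightarrow> bool" where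
  "operator_to_dual scaleE P \<longleftrightarrow>
     (\<forall>a w v. blinfun_apply (blinfun_apply P (scaleE a w)) v
               = a * blinfun_apply (blinfun_apply P w) v) \<and>
     (\<forall>a w v. blinfun_apply (blinfun_apply P w) (scaleE a v)
               = conjug a * blinfun_apply (blinfun_apply P w) v)"

definition pairing :: "'e::real_normed_vector \<Rightarrow> ('e \<Rightarrow>\<^sub>L 'k::real_or_complex) \<Rightarrow> 'k" where
  "pairing v f = blinfun_apply f v"

definition symmetric_operator ::
    "('e::real_normed_vector \<Rightarrow>\<^sub>L 'e \<Rightarrow>\<^sub>L 'k::real_or_complex) \<Rightarrow> bool" where
  "symmetric_operator P \<longleftrightarrow>
     (\<forall>v1 v2. pairing v1 (blinfun_apply P v2) = conjug (pairing v2 (blinfun_apply P v1)))"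

text \<open>
  For symmetric \<open>P\<close> the scalar \<open>\<langle>v, P v\<rangle>\<close> is self-conjugate, i.e.\ real; \<^const>\<open>real_part\<close>
  only moves it to the type \<^typ>\<open>real\<close>.
\<close>

definition quadratic_form ::
    "('e::real_normed_vector \<Rightarrow>\<^sub>L 'e \<Rightarrow>\<^sub>L 'k::real_or_complex) \<Rightarrow> 'e \<Rightarrow> real" where
  "quadratic_form P v = real_part (pairing v (blinfun_apply P v))"

section \<open>Flows, cocycles and almost periodicity\<close>

definition relatively_dense :: "real set \<Rightarrow> bool" where
  "relatively_dense S \<longleftrightarrow> (\<exists>L>0. \<forall>a. \<exists>\<tau>\<in>S. a \<le> \<tau> \<and> \<tau> \<le> a + L)"

definition is_flow :: "(real \<Rightarrow> 'q::topological_space \<Rightarrow> 'q) \<Rightarrow> bool" where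
  "is_flow \<theta> \<longleftrightarrow>
     (\<forall>q. \<theta> 0 q = q) \<and> (\<forall>t s q. \<theta> (t + s) q = \<theta> t (\<theta> s q)) \<and>
     continuous_on UNIV (\<lambda>(t, q). \<theta> t q)"

definition minimal_flow :: "(real \<Rightarrow> 'q::topological_space \<Rightarrow> 'q) \<Rightarrow> bool" where
  "minimal_flow \<theta> \<longleftrightarrow> (\<forall>q. closure (range (\<lambda>t. \<theta> t q)) = UNIV)"

text \<open>On a compact space the supremum is that of a bounded nonempty set of reals.\<close>

definition almost_periodic_flow :: "(real \<Rightarrow> 'q::metric_space \<Rightarrow> 'q) \<Rightarrow> bool" where
  "almost_periodic_flow \<theta> \<longleftrightarrow>
     (\<forall>\<epsilon>>0. relatively_dense {\<tau>. (SUP q. dist (\<theta> \<tau> q) q) < \<epsilon>})"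

text \<open>A cocycle is only evaluated at times \<open>t \<ge> 0\<close>; its values at \<open>t < 0\<close> are irrelevant.\<close>

definition cocycle ::
    "(real \<Rightarrow> 'q::topological_space \<Rightarrow> 'q) \<Rightarrow>
     (real \<Rightarrow> 'q \<Rightarrow> 'e::topological_space \<Rightarrow> 'e) \<Rightarrow> bool" where
  "cocycle \<theta> \<psi> \<longleftrightarrow>
     (\<forall>q v. \<psi> 0 q v = v) \<and>
     (\<forall>t\<ge>0. \<forall>s\<ge>0. \<forall>q v. \<psi> (t + s) q v = \<psi> t (\<theta> s q) (\<psi> s q v)) \<and>
     continuous_on ({0..} \<times> UNIV \<times> UNIV) (\<lambda>(t, q, v). \<psi> t q v)"

definition complete_trajectory ::
    "(real \<Rightarrow> 'q \<Rightarrow> 'q) \<Rightarrow> (real \<Rightarrow> 'q \<Rightarrow> 'e::topological_space \<Rightarrow> 'e) \<Rightarrow>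
     'q \<Rightarrow> (real \<Rightarrow> 'e) \<Rightarrow> bool" where
  "complete_trajectory \<theta> \<psi> q v \<longleftrightarrow>
     continuous_on UNIV v \<and> (\<forall>t\<ge>0. \<forall>s. v (t + s) = \<psi> t (\<theta> s q) (v s))"

definition bohr_almost_periodic :: "(real \<Rightarrow> 'e::real_normed_vector) \<Rightarrow> bool" where
  "bohr_almost_periodic f \<longleftrightarrow>
     continuous_on UNIV f \<and>
     (\<forall>\<epsilon>>0. relatively_dense {\<tau>. \<forall>t. norm (f (t + \<tau>) - f t) \<le> \<epsilon>})"

definition almost_periodic_trajectory ::
    "(real \<Rightarrow> 'q \<Rightarrow> 'q) \<Rightarrow> (real \<Rightarrow> 'q \<Rightarrow> 'e::real_normed_vector \<Rightarrow> 'e) \<Rightarrow>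
     'q \<Rightarrow> (real \<Rightarrow> 'e) \<Rightarrow> bool" where
  "almost_periodic_trajectory \<theta> \<psi> q v \<longleftrightarrow>
     complete_trajectory \<theta> \<psi> q v \<and> bohr_almost_periodic v"

section \<open>Squeezing, Lipschitz property and asymptotic compactness\<close>

text \<open>The exponent \<open>\<nu>(t;q)\<close>; it is used for \<open>t \<ge> 0\<close> only.\<close>

definition cumulative_exponent ::
    "(real \<Rightarrow> 'q \<Rightarrow> 'q) \<Rightarrow> ('q \<Rightarrow> real) \<Rightarrow> real \<Rightarrow> 'q \<Rightarrow> real" where
  "cumulative_exponent \<theta> \<nu>\<^sub>0 t q = integral {0..t} (\<lambda>s. \<nu>\<^sub>0 (\<theta> s q))"

definition squeezing_property ::
    "(real \<Rightarrow> 'q::topological_space \<Rightarrow> 'q) \<Rightarrow>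
     (real \<Rightarrow> 'q \<Rightarrow> 'e::real_normed_vector \<Rightarrow> 'e) \<Rightarrow>
     ('e \<Rightarrow> 'h::real_normed_vector) \<Rightarrow>
     ('q \<Rightarrow> 'e \<Rightarrow>\<^sub>L 'e \<Rightarrow>\<^sub>L 'k::real_or_complex) \<Rightarrow>
     ('q \<Rightarrow> real) \<Rightarrow> real \<Rightarrow> real \<Rightarrow> real \<Rightarrow> real \<Rightarrow> bool" where
  "squeezing_property \<theta> \<psi> J P \<nu>\<^sub>0 \<nu>_minus \<nu>_plus \<delta> \<tau> \<longleftrightarrow>
     \<nu>_minus < \<nu>_plus \<and> \<delta> > 0 \<and> \<tau> \<ge> 0 \<and>
     \<nu>\<^sub>0 \<in> borel_measurable borel \<and>
     (\<forall>q. 0 \<le> \<nu>\<^sub>0 q \<and> \<nu>_minus \<le> \<nu>\<^sub>0 q \<and> \<nu>\<^sub>0 q \<le> \<nu>_plus) \<and>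
     (\<forall>q v1 v2 l r. l \<ge> 0 \<longrightarrow> r \<ge> 0 \<longrightarrow> r - l \<ge> \<tau> \<longrightarrow>
        exp (2 * cumulative_exponent \<theta> \<nu>\<^sub>0 r q)
            * quadratic_form (P (\<theta> r q)) (\<psi> r q v1 - \<psi> r q v2)
        - exp (2 * cumulative_exponent \<theta> \<nu>\<^sub>0 l q)
            * quadratic_form (P (\<theta> l q)) (\<psi> l q v1 - \<psi> l q v2)
        \<le> - \<delta> * integral {l..r}
              (\<lambda>s. exp (2 * cumulative_exponent \<theta> \<nu>\<^sub>0 s q)
                     * (norm (J (\<psi> s q v1 - \<psi> s q v2)))\<^sup>2))"

definition uniform_lipschitz_property ::
    "(real \<Rightarrow> 'q \<Rightarrow> 'e::real_normed_vector \<Rightarrow> 'e) \<Rightarrow> ('e \<Rightarrow> 'h::real_normed_vector) \<Rightarrow> bool" where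
  "uniform_lipschitz_property \<psi> J \<longleftrightarrow>
     (\<exists>\<tau>\<ge>0. \<forall>T>0. \<exists>L>0. \<forall>q v1 v2.
        (\<forall>t\<in>{\<tau>..\<tau> + T}. norm (\<psi> t q v1 - \<psi> t q v2) \<le> L * norm (J (v1 - v2))) \<and>
        (\<forall>t\<in>{0..T}. norm (\<psi> t q v1 - \<psi> t q v2) \<le> L * norm (v1 - v2)))"

text \<open>
  The measure of noncompactness takes values in \<open>[0,\<infinity>]\<close>, so that it is \<open>\<infinity>\<close> (the infimum of the
  empty set) on unbounded sets. Boundedness is required because \<^const>\<open>diameter\<close> is a meaningless
  real number for unbounded sets.
\<close>

definition kuratowski_measure :: "'e::metric_space set \<Rightarrow> ennreal" where
  "kuratowski_measure B =
     Inf {ennreal d | d. d > 0 \<and>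
            (\<exists>F. finite F \<and> B \<subseteq> \<Union>F \<and> (\<forall>A\<in>F. bounded A \<and> diameter A \<le> d))}"

definition asymptotically_compact ::
    "(real \<Rightarrow> 'q::topological_space \<Rightarrow> 'e::metric_space \<Rightarrow> 'e) \<Rightarrow> real \<Rightarrow> bool" where
  "asymptotically_compact \<psi> \<gamma> \<longleftrightarrow>
     (\<forall>C. compact C \<longrightarrow>
        (\<exists>\<gamma>\<^sub>0 :: real \<Rightarrow> real.
           (\<forall>t\<ge>0. \<gamma>\<^sub>0 t \<ge> 0) \<and> (\<gamma>\<^sub>0 \<longlongrightarrow> 0) at_top \<and>
           (\<forall>t\<ge>0. \<forall>B. bounded B \<longrightarrow>
              kuratowski_measure ((\<lambda>(q, v). \<psi> t q v) ` (C \<times> B))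
                \<le> ennreal (\<gamma>\<^sub>0 t * exp (- \<gamma> * t)) * kuratowski_measure B)))"

end

theory Submission
  imports Defs
begin

text \<open>
  Because \<open>V\<^sub>q\<close> is positive, the first term of the squeezing inequality on \<open>[0, r]\<close> may be
  dropped: for the difference \<open>w\<close> of two trajectories over \<open>q\<close> it becomes
  \<open>\<delta> \<integral>\<^bsub>[0,r]\<^esub> e\<^bsup>2\<nu>(s;q)\<^esup> |w(s)|\<^sup>2 ds \<le> V\<^sub>q(w(0)) \<le> \<parallel>P(q)\<parallel> \<parallel>w(0)\<parallel>\<^sup>2\<close>.
  The smoothing half of the Lipschitz property bounds the \<open>E\<close>-norm at time \<open>t\<close> by the
  \<open>H\<close>-norm at every instant of a window of unit length shortly before \<open>t\<close>, hence by the integral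
  over that window. The result (lemma \<open>squeezing_contraction\<close>) is that any two trajectories over
  the same \<open>q\<close> approach each other at the rate \<open>e\<^bsup>-\<nu>(t;q)\<^esup>\<close>, uniformly in \<open>q\<close>. This already is
  the stability estimate, whatever the trajectory \<open>v\<^sup>*\<close> will be.

  It remains to find one almost periodic trajectory over each \<open>q\<close>. The given precompact orbit over
  \<open>q\<^sub>0\<close> spreads to all of the base: almost periodicity makes the forward orbit of \<open>q\<^sub>0\<close> dense,
  and limits of the given orbit along times \<open>t\<^sub>n\<close> with \<open>\<theta>\<^bsup>t\<^sub>n\<^esup> q\<^sub>0 \<rightarrow> q\<close> start
  orbits over \<open>q\<close> in the same compact set (lemma \<open>precompact_orbit_over_every_point\<close>). By contraction,
  the forward orbits of a fixed \<open>x\<^sub>0\<close> are then bounded uniformly in \<open>q\<close>, so the pullbacks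
  \<open>\<psi>\<^sup>T(\<theta>\<^bsup>-T\<^esup> q, x\<^sub>0)\<close> converge, uniformly in \<open>q\<close>, as \<open>T\<close> tends to infinity. Their limit \<open>\<Phi>\<close> is a
  continuous invariant section (lemma \<open>pullback_section\<close>), and \<open>t \<mapsto> \<Phi>(\<theta>\<^sup>t q)\<close> inherits almost
  periodicity from the base because \<open>\<Phi>\<close> is uniformly continuous. An almost periodic
  trajectory is bounded on the whole line, and contraction from time \<open>-\<infinity>\<close> leaves room for only one
  bounded complete trajectory over \<open>q\<close>.
\<close>

section \<open>Bounds for the quadratic form\<close>

lemma norm_conjug: "norm (conjug x) = norm x" for x :: "'k::real_or_complex"
proof (cases "x = 0")
  case True
  then show ?thesis using conjug_of_real[of 0, where 'k='k] by simp
next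
  case False
  have "norm x * norm (conjug x) = norm x * norm x"
    using arg_cong[OF mult_conjug[of x], of norm]
    by (simp add: norm_mult power2_eq_square flip: of_real_mult)
  with False show ?thesis by simp
qed

lemma abs_real_part_le_norm: "\<bar>real_part x\<bar> \<le> norm x" for x :: "'k::real_or_complex"
proof -
  have "\<bar>real_part x\<bar> = norm (of_real (real_part x) :: 'k)" by simp
  also have "\<dots> = norm (x + conjug x) / 2"
    by (simp only: of_real_real_part norm_divide norm_numeral)
  also have "\<dots> \<le> norm x"
    using norm_triangle_ineq[of x "conjug x"] by (simp add: norm_conjug)
  finally show ?thesis .
qed

lemma quadratic_form_le: "quadratic_form P v \<le> norm P * (norm v)\<^sup>2"
proof -
  have "quadratic_form P v \<le> norm (blinfun_apply (blinfun_apply P v) v)"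
    unfolding quadratic_form_def pairing_def
    using abs_real_part_le_norm[of "blinfun_apply (blinfun_apply P v) v"] by linarith
  also have "\<dots> \<le> norm (blinfun_apply P v) * norm v" by (rule norm_blinfun)
  also have "\<dots> \<le> norm P * norm v * norm v" by (intro mult_right_mono norm_blinfun) simp
  finally show ?thesis by (simp add: power2_eq_square mult.assoc)
qed

lemma quadratic_form_zero: "quadratic_form P 0 = 0"
  using abs_real_part_le_norm[of "0::'b"]
  by (simp add: quadratic_form_def pairing_def blinfun.zero_left blinfun.zero_right)

section \<open>Continuity along flows and cocycles\<close>

lemma flow_continuous:
  assumes "is_flow \<theta>" "continuous_on S f" "continuous_on S g"
  shows "continuous_on S (\<lambda>x. \<theta> (f x) (g x))"
proof -
  have "continuous_on UNIV (\<lambda>(t, q). \<theta> t q)" using assms(1) by (simp add: is_flow_def)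
  from continuous_on_compose2[OF this continuous_on_Pair[OF assms(2,3)]]
  show ?thesis by simp
qed

lemma cocycle_continuous:
  assumes "cocycle \<theta> \<psi>" "continuous_on S f" "continuous_on S g" "continuous_on S h"
    and "\<And>x. x \<in> S \<Longrightarrow> f x \<ge> 0"
  shows "continuous_on S (\<lambda>x. \<psi> (f x) (g x) (h x))"
proof -
  have c: "continuous_on ({0..} \<times> UNIV \<times> UNIV) (\<lambda>(t, q, v). \<psi> t q v)"
    using assms(1) by (simp add: cocycle_def)
  have "continuous_on S (\<lambda>x. (f x, g x, h x))"
    by (intro continuous_on_Pair assms)
  from continuous_on_compose2[OF c this] assms(5) show ?thesis by auto
qed

lemma cumulative_exponent_increment:
  assumes "is_flow \<theta>" "continuous_on UNIV \<nu>" "\<And>q. a \<le> \<nu> q" "\<And>q. \<nu> q \<le> b"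
    and "0 \<le> s" "s \<le> t"
  shows "a * (t - s) \<le> cumulative_exponent \<theta> \<nu> t q - cumulative_exponent \<theta> \<nu> s q"
    and "cumulative_exponent \<theta> \<nu> t q - cumulative_exponent \<theta> \<nu> s q \<le> b * (t - s)"
proof -
  have cont: "continuous_on S (\<lambda>s. \<nu> (\<theta> s q))" for S
    by (intro continuous_on_compose2[OF assms(2)] flow_continuous[OF assms(1)] continuous_intros)
      auto
  then have int: "(\<lambda>s. \<nu> (\<theta> s q)) integrable_on {x..y}" for x y
    by (intro integrable_continuous_interval)
  have eq: "cumulative_exponent \<theta> \<nu> t q - cumulative_exponent \<theta> \<nu> s q
      = integral {s..t} (\<lambda>s. \<nu> (\<theta> s q))"
    unfolding cumulative_exponent_def
    using Henstock_Kurzweil_Integration.integral_combine[OF assms(5,6) int] by linarith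
  have "integral {s..t} (\<lambda>_. a) \<le> integral {s..t} (\<lambda>s. \<nu> (\<theta> s q))"
    by (intro integral_le int assms integrable_const_ivl)
  then show "a * (t - s) \<le> cumulative_exponent \<theta> \<nu> t q - cumulative_exponent \<theta> \<nu> s q"
    using assms(6) unfolding eq by (simp add: mult.commute)
  have "integral {s..t} (\<lambda>s. \<nu> (\<theta> s q)) \<le> integral {s..t} (\<lambda>_. b)"
    by (intro integral_le int assms integrable_const_ivl)
  then show "cumulative_exponent \<theta> \<nu> t q - cumulative_exponent \<theta> \<nu> s q \<le> b * (t - s)"
    using assms(6) unfolding eq by (simp add: mult.commute)
qed

lemma cumulative_exponent_continuous:
  assumes "is_flow \<theta>" "continuous_on UNIV \<nu>"
  shows "continuous_on {0..r} (\<lambda>t. cumulative_exponent \<theta> \<nu> t q)"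
proof -
  have "continuous_on {0..r} (\<lambda>s. \<nu> (\<theta> s q))"
    by (intro continuous_on_compose2[OF assms(2)] flow_continuous[OF assms(1)] continuous_intros)
      auto
  then show ?thesis
    unfolding cumulative_exponent_def
    by (intro indefinite_integral_continuous_1 integrable_continuous_interval)
qed

section \<open>Squeezing by a positive form is contraction\<close>

text \<open>
  Long times are controlled by the squeezing integral, as explained at the beginning; times up to
  \<open>\<sigma> + 1\<close>, for which the smoothing window would reach below time zero, by the plain Lipschitz bound.
  Trading the weight \<open>e\<^bsup>2\<nu>(s;q)\<^esup>\<close> on the window for \<open>e\<^bsup>2\<nu>(t;q)\<^esup>\<close> costs only a constant, since
  \<open>\<nu>\<close> grows at rate at most \<open>b\<close>.
\<close>

lemma squeezing_contraction:
  fixes \<psi> :: "real \<Rightarrow> 'q::topological_space \<Rightarrow> 'e::real_normed_vector \<Rightarrow> 'e"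
    and P :: "'q \<Rightarrow> 'e \<Rightarrow>\<^sub>L 'e \<Rightarrow>\<^sub>L 'k::real_or_complex"
    and J :: "'e \<Rightarrow> 'h::real_normed_vector"
  assumes flow: "is_flow \<theta>" and coc: "cocycle \<theta> \<psi>" and J: "bounded_linear J"
    and P: "bounded (range P)" and V: "\<And>q v. quadratic_form (P q) v \<ge> 0"
    and squeeze: "squeezing_property \<theta> \<psi> J P \<nu> a b \<delta> \<tau>" and \<nu>: "continuous_on UNIV \<nu>"
    and lip: "uniform_lipschitz_property \<psi> J"
  shows "\<exists>M>0. \<forall>q v1 v2. \<forall>t\<ge>0. norm (\<psi> t q v1 - \<psi> t q v2)
           \<le> M * exp (- cumulative_exponent \<theta> \<nu> t q) * norm (v1 - v2)"
proof -
  obtain p where p: "norm (P q) \<le> p" for q using P by (auto simp: bounded_iff)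
  have p0: "p \<ge> 0" using norm_ge_zero p order_trans by blast
  have sq: "\<delta> > 0" "\<tau> \<ge> 0" "\<And>q. 0 \<le> \<nu> q" "\<And>q. \<nu> q \<le> b"
    using squeeze by (auto simp: squeezing_property_def)
  have b0: "b \<ge> 0" using sq(3,4) order_trans by blast
  obtain \<sigma> where \<sigma>: "\<sigma> \<ge> 0" and "\<forall>T>0. \<exists>L>0. \<forall>q v1 v2.
        (\<forall>t\<in>{\<sigma>..\<sigma> + T}. norm (\<psi> t q v1 - \<psi> t q v2) \<le> L * norm (J (v1 - v2))) \<and>
        (\<forall>t\<in>{0..T}. norm (\<psi> t q v1 - \<psi> t q v2) \<le> L * norm (v1 - v2))"
    using lip unfolding uniform_lipschitz_property_def by blast
  \<comment> \<open>\<open>T = \<sigma> + 1\<close> serves both halves: it covers the smoothing window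
      \<open>[\<sigma>, \<sigma> + 1]\<close> and the short times \<open>[0, \<sigma> + 1]\<close>.\<close>
  then obtain L where L: "L > 0"
    and smoothing: "\<And>t q v1 v2. t \<in> {\<sigma>..\<sigma> + (\<sigma> + 1)} \<Longrightarrow>
          norm (\<psi> t q v1 - \<psi> t q v2) \<le> L * norm (J (v1 - v2))"
    and short_time: "\<And>t q v1 v2. t \<in> {0..\<sigma> + 1} \<Longrightarrow>
          norm (\<psi> t q v1 - \<psi> t q v2) \<le> L * norm (v1 - v2)"
    using add_nonneg_pos[OF \<sigma> zero_less_one] by metis
  define E where "E = exp (b * (\<sigma> + 1))"
  define M where "M = L * E * (1 + sqrt (p / \<delta>))"
  have E: "E > 0" by (simp add: E_def)
  have M: "M > 0" unfolding M_def using L E p0 sq(1)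
    by (intro mult_pos_pos add_pos_nonneg) auto
  have "norm (\<psi> t q v1 - \<psi> t q v2)
           \<le> M * exp (- cumulative_exponent \<theta> \<nu> t q) * norm (v1 - v2)" if t: "t \<ge> 0" for q v1 v2 t
  proof -
    let ?N = "\<lambda>t. cumulative_exponent \<theta> \<nu> t q"
    let ?w = "\<lambda>t. \<psi> t q v1 - \<psi> t q v2"
    have N0: "?N 0 = 0" by (simp add: cumulative_exponent_def)
    have N: "?N t - ?N s \<le> b * (\<sigma> + 1)" if "0 \<le> s" "s \<le> t" "t - s \<le> \<sigma> + 1" for s
      using cumulative_exponent_increment(2)[OF flow \<nu> sq(3,4) that(1,2), of q]
        mult_left_mono[OF that(3) b0] by linarith
    have "exp (?N t) * norm (?w t) \<le> M * norm (v1 - v2)"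
    proof (cases "t \<le> \<sigma> + 1")
      case True
      have "exp (?N t) * norm (?w t) \<le> E * (L * norm (v1 - v2))"
        unfolding E_def using N[of 0] N0 True t
        by (intro mult_mono short_time) auto
      also have "\<dots> \<le> M * norm (v1 - v2)"
        using L E p0 sq(1) unfolding M_def by (simp add: algebra_simps)
      finally show ?thesis .
    next
      case False
      let ?f = "\<lambda>s. exp (2 * ?N s) * (norm (J (?w s)))\<^sup>2"
      let ?c = "(exp (?N t) * norm (?w t))\<^sup>2"
      \<comment> \<open>squeezing holds only on intervals of length at least \<open>\<tau>\<close>, hence the overshoot\<close>
      define r where "r = t + \<tau>"
      have r: "r \<ge> t" "r \<ge> 0" "r - 0 \<ge> \<tau>" using t sq(2) by (auto simp: r_def)
      have wc: "continuous_on {0..r} ?w"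
        by (intro continuous_intros cocycle_continuous[OF coc]) auto
      have fc: "continuous_on {0..r} ?f"
        by (intro continuous_intros cumulative_exponent_continuous[OF flow \<nu>]
            bounded_linear.continuous_on[OF J] wc)
      then have fi: "?f integrable_on {0..r}" by (rule integrable_continuous_interval)
      let ?I = "{t - (\<sigma> + 1)..t - \<sigma>}"
      have sub: "?I \<subseteq> {0..r}" using False r \<sigma> by auto
      have fi': "?f integrable_on ?I"
        using continuous_on_subset[OF fc sub] by (rule integrable_continuous_interval)
      have pointwise: "?c \<le> (L * E)\<^sup>2 * ?f s" if s: "s \<in> ?I" for s
      proof -
        have s': "0 \<le> s" "0 \<le> t - s" "s \<le> t" "t - s \<le> \<sigma> + 1" "t - s \<in> {\<sigma>..\<sigma> + (\<sigma> + 1)}"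
          using s False \<sigma> by auto
        have *: "\<psi> t q v = \<psi> (t - s) (\<theta> s q) (\<psi> s q v)" for v
          using coc s' unfolding cocycle_def by (metis diff_add_cancel)
        have "norm (?w t) \<le> L * norm (J (?w s))"
          unfolding *[of v1] *[of v2] by (rule smoothing[OF s'(5)])
        moreover have "exp (?N t) \<le> E * exp (?N s)"
          using N[OF s'(1,3,4)] by (simp add: E_def flip: exp_add)
        ultimately have "exp (?N t) * norm (?w t) \<le> (E * exp (?N s)) * (L * norm (J (?w s)))"
          using E by (intro mult_mono) auto
        then have "?c \<le> ((E * exp (?N s)) * (L * norm (J (?w s))))\<^sup>2"
          by (intro power_mono) auto
        then show ?thesis
          by (simp add: power_mult_distrib mult_ac flip: exp_double)
      qed
      have "?c = integral ?I (\<lambda>_. ?c)" by simp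
      also have "\<dots> \<le> integral ?I (\<lambda>s. (L * E)\<^sup>2 * ?f s)"
        by (intro integral_le integrable_on_mult_right fi' pointwise integrable_const_ivl)
      also have "\<dots> = (L * E)\<^sup>2 * integral ?I ?f" by simp
      also have "\<dots> \<le> (L * E)\<^sup>2 * integral {0..r} ?f"
        by (intro mult_left_mono integral_subset_le sub fi fi') auto
      also have "\<dots> \<le> (L * E)\<^sup>2 * (p / \<delta> * (norm (v1 - v2))\<^sup>2)"
      proof (rule mult_left_mono)
        have "exp (2 * ?N r) * quadratic_form (P (\<theta> r q)) (?w r)
            - exp (2 * ?N 0) * quadratic_form (P (\<theta> 0 q)) (?w 0)
            \<le> - \<delta> * integral {0..r} ?f"
          using squeeze r unfolding squeezing_property_def by blast
        moreover have "0 \<le> exp (2 * ?N r) * quadratic_form (P (\<theta> r q)) (?w r)"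
          using V by simp
        moreover have "exp (2 * ?N 0) * quadratic_form (P (\<theta> 0 q)) (?w 0) \<le> p * (norm (v1 - v2))\<^sup>2"
        proof -
          have "?w 0 = v1 - v2" "\<theta> 0 q = q"
            using coc flow by (auto simp: cocycle_def is_flow_def)
          then show ?thesis
            using N0 order_trans[OF quadratic_form_le[of "P q" "v1 - v2"]
              mult_right_mono[OF p[of q] zero_le_power2]] by simp
        qed
        ultimately have "\<delta> * integral {0..r} ?f \<le> p * (norm (v1 - v2))\<^sup>2" by linarith
        then show "integral {0..r} ?f \<le> p / \<delta> * (norm (v1 - v2))\<^sup>2"
          using sq(1) by (simp add: field_simps)
      qed simp
      also have "\<dots> = (L * E * sqrt (p / \<delta>) * norm (v1 - v2))\<^sup>2"
        using p0 sq(1) by (simp add: power_mult_distrib)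
      finally have "exp (?N t) * norm (?w t) \<le> L * E * sqrt (p / \<delta>) * norm (v1 - v2)"
        using L E p0 sq(1) by (elim power2_le_imp_le) auto
      also have "\<dots> \<le> M * norm (v1 - v2)"
        unfolding M_def using L E by (intro mult_right_mono) (auto simp: algebra_simps)
      finally show ?thesis .
    qed
    then show ?thesis by (simp add: exp_minus field_simps)
  qed
  with M show ?thesis by blast
qed

section \<open>Consequences of almost periodicity\<close>

text \<open>Every value is, up to an error of one, attained on a compact interval: shift by a
  \<open>1\<close>-almost-period that brings the argument into \<open>[0, L]\<close>.\<close>

lemma bohr_almost_periodic_imp_bounded:
  assumes "bohr_almost_periodic f"
  shows "bounded (range f)"
proof -
  have cont: "continuous_on UNIV f"
    and "relatively_dense {\<tau>. \<forall>t. norm (f (t + \<tau>) - f t) \<le> 1}"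
    using assms by (auto simp: bohr_almost_periodic_def)
  then obtain L where "L > 0"
    and L: "\<And>a. \<exists>\<tau>. (\<forall>t. norm (f (t + \<tau>) - f t) \<le> 1) \<and> a \<le> \<tau> \<and> \<tau> \<le> a + L"
    unfolding relatively_dense_def by blast
  have "compact (f ` {0..L})"
    by (intro compact_continuous_image continuous_on_subset[OF cont]) auto
  then obtain B where B: "\<And>s. s \<in> {0..L} \<Longrightarrow> norm (f s) \<le> B"
    using compact_imp_bounded by (force simp: bounded_iff)
  have "norm (f t) \<le> B + 1" for t
  proof -
    obtain \<tau> where \<tau>: "\<forall>t. norm (f (t + \<tau>) - f t) \<le> 1" "- t \<le> \<tau>" "\<tau> \<le> - t + L"
      using L by blast
    have "norm (f t) \<le> norm (f (t + \<tau>)) + norm (f (t + \<tau>) - f t)"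
      by (metis norm_minus_commute norm_triangle_sub)
    then show ?thesis using B[of "t + \<tau>"] \<tau> by (smt (verit) atLeastAtMost_iff)
  qed
  then show ?thesis by (auto simp: bounded_iff)
qed

lemma relatively_dense_mono:
  assumes "relatively_dense S" "S \<subseteq> T"
  shows "relatively_dense T"
  using assms unfolding relatively_dense_def by (meson subsetD)

lemma almost_periodic_flow_returns:
  fixes \<theta> :: "real \<Rightarrow> 'q::metric_space \<Rightarrow> 'q"
  assumes "compact (UNIV :: 'q set)" "almost_periodic_flow \<theta>" "\<epsilon> > 0"
  shows "relatively_dense {\<tau>. \<forall>q. dist (\<theta> \<tau> q) q < \<epsilon>}"
proof (rule relatively_dense_mono)
  show "relatively_dense {\<tau>. (SUP q. dist (\<theta> \<tau> q) q) < \<epsilon>}"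
    using assms(2,3) by (simp add: almost_periodic_flow_def)
  have bdd: "bdd_above (range (\<lambda>q. dist (\<theta> \<tau> q) q))" for \<tau>
    using diameter_bounded_bound[OF compact_imp_bounded[OF assms(1)] UNIV_I UNIV_I]
    by (rule bdd_aboveI2)
  show "{\<tau>. (SUP q. dist (\<theta> \<tau> q) q) < \<epsilon>} \<subseteq> {\<tau>. \<forall>q. dist (\<theta> \<tau> q) q < \<epsilon>}"
  proof (intro subsetI CollectI allI)
    fix \<tau> q assume "\<tau> \<in> {\<tau>. (SUP q. dist (\<theta> \<tau> q) q) < \<epsilon>}"
    then have "(SUP q. dist (\<theta> \<tau> q) q) < \<epsilon>" by (rule CollectD)
    with cSUP_upper[OF UNIV_I bdd, of \<tau> q] show "dist (\<theta> \<tau> q) q < \<epsilon>" by linarith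
  qed
qed

text \<open>Minimality reaches the vicinity of \<open>q\<close> at some time, possibly negative; adding a large
  almost-period makes the time nonnegative and moves the orbit point only slightly.\<close>

lemma forward_orbit_dense:
  fixes \<theta> :: "real \<Rightarrow> 'q::metric_space \<Rightarrow> 'q"
  assumes "compact (UNIV :: 'q set)" "is_flow \<theta>" "minimal_flow \<theta>" "almost_periodic_flow \<theta>"
    and "\<epsilon> > 0"
  shows "\<exists>t\<ge>0. dist (\<theta> t p) q < \<epsilon>"
proof -
  have "q \<in> closure (range (\<lambda>t. \<theta> t p))" using assms(3) by (simp add: minimal_flow_def)
  then obtain t where t: "dist (\<theta> t p) q < \<epsilon> / 2"
    unfolding closure_approachable using assms(5) half_gt_zero by blast
  obtain \<tau> where \<tau>: "\<And>q. dist (\<theta> \<tau> q) q < \<epsilon> / 2" "- t \<le> \<tau>"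
    using almost_periodic_flow_returns[OF assms(1,4) half_gt_zero[OF assms(5)]]
    unfolding relatively_dense_def by blast
  have "\<theta> (\<tau> + t) p = \<theta> \<tau> (\<theta> t p)" using assms(2) by (simp add: is_flow_def)
  then have "dist (\<theta> (\<tau> + t) p) q < \<epsilon>"
    using \<tau>(1)[of "\<theta> t p"] t dist_triangle_half_r[of "\<theta> t p" "\<theta> (\<tau> + t) p" \<epsilon> q] by (simp add: dist_commute)
  with \<tau>(2) show ?thesis by (intro exI[of _ "\<tau> + t"]) auto
qed

text \<open>The starting point \<open>x\<close> over \<open>q\<close> is a limit point of the given orbit along times at which the
  base point tends to \<open>q\<close>; its orbit is then a pointwise limit of shifts of the given one.\<close>

lemma precompact_orbit_over_every_point:
  fixes \<theta> :: "real \<Rightarrow> 'q::metric_space \<Rightarrow> 'q"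
    and \<psi> :: "real \<Rightarrow> 'q \<Rightarrow> 'e::metric_space \<Rightarrow> 'e"
  assumes coc: "cocycle \<theta> \<psi>"
    and dense: "\<And>\<epsilon>. \<epsilon> > 0 \<Longrightarrow> \<exists>t\<ge>0. dist (\<theta> t p) q < \<epsilon>"
    and K: "compact K" "\<And>t. t \<ge> 0 \<Longrightarrow> \<psi> t p u \<in> K"
  shows "\<exists>x\<in>K. \<forall>t\<ge>0. \<psi> t q x \<in> K"
proof -
  have "\<exists>t\<ge>0. dist (\<theta> t p) q < inverse (real (Suc n))" for n
    by (rule dense) (simp del: of_nat_Suc)
  then have "\<forall>n. \<exists>t. t \<ge> 0 \<and> dist (\<theta> t p) q < inverse (real (Suc n))" by blast
  from choice[OF this] obtain t
    where t: "\<And>n. t n \<ge> 0" "\<And>n. dist (\<theta> (t n) p) q < inverse (real (Suc n))" by blast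
  have "(\<lambda>n. dist (\<theta> (t n) p) q) \<longlonglongrightarrow> 0"
  proof (rule Lim_null_comparison[OF _ LIMSEQ_inverse_real_of_nat])
    show "\<forall>\<^sub>F n in sequentially. norm (dist (\<theta> (t n) p) q) \<le> inverse (real (Suc n))"
      using t(2) by (intro always_eventually allI)
        (simp del: of_nat_Suc add: order.strict_implies_order)
  qed
  then have q: "(\<lambda>n. \<theta> (t n) p) \<longlonglongrightarrow> q" by (rule iffD2[OF tendsto_dist_iff])
  have "\<forall>n. \<psi> (t n) p u \<in> K" using K(2) t(1) by blast
  from K(1)[unfolded compact_def, THEN spec, THEN mp, OF this] obtain x r
    where x: "x \<in> K" "strict_mono r" "((\<lambda>n. \<psi> (t n) p u) \<circ> r) \<longlonglongrightarrow> x"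
    by (elim bexE exE conjE)
  have "\<psi> s q x \<in> K" if s: "s \<ge> 0" for s
  proof -
    have c: "continuous_on UNIV (\<lambda>y. \<psi> s (fst y) (snd y))"
      using s by (intro cocycle_continuous[OF coc] continuous_intros) auto
    have "(\<lambda>n. (\<theta> (t (r n)) p, \<psi> (t (r n)) p u)) \<longlonglongrightarrow> (q, x)"
      using tendsto_Pair[OF LIMSEQ_subseq_LIMSEQ[OF q x(2)] x(3)] by (simp add: comp_def)
    from continuous_on_tendsto_compose[OF c this]
    have "(\<lambda>n. \<psi> s (\<theta> (t (r n)) p) (\<psi> (t (r n)) p u)) \<longlonglongrightarrow> \<psi> s q x" by simp
    moreover have "\<psi> s (\<theta> (t (r n)) p) (\<psi> (t (r n)) p u) \<in> K" for n
    proof -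
      have "\<psi> s (\<theta> (t (r n)) p) (\<psi> (t (r n)) p u) = \<psi> (s + t (r n)) p u"
        using coc s t(1) by (simp add: cocycle_def)
      then show ?thesis using K(2) s t(1) by simp
    qed
    ultimately show ?thesis
      by (rule closed_sequentially[OF compact_imp_closed[OF K(1)], rotated])
  qed
  with x(1) show ?thesis by blast
qed

section \<open>Uniformly contracting cocycles\<close>

locale contracting_cocycle =
  fixes \<theta> :: "real \<Rightarrow> 'q::metric_space \<Rightarrow> 'q"
    and \<psi> :: "real \<Rightarrow> 'q \<Rightarrow> 'e::banach \<Rightarrow> 'e"
    and M a :: real
  assumes flow: "is_flow \<theta>" and coc: "cocycle \<theta> \<psi>" and a: "a > 0" and M: "M > 0"
    and contraction: "t \<ge> 0 \<Longrightarrow>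
      norm (\<psi> t q v1 - \<psi> t q v2) \<le> M * exp (- a * t) * norm (v1 - v2)"
begin

lemma flow_add: "\<theta> (t + s) q = \<theta> t (\<theta> s q)" and flow_0: "\<theta> 0 q = q"
  using flow by (auto simp: is_flow_def)

lemma cocycle_add: "t \<ge> 0 \<Longrightarrow> s \<ge> 0 \<Longrightarrow> \<psi> (t + s) q v = \<psi> t (\<theta> s q) (\<psi> s q v)"
  using coc by (simp add: cocycle_def)

lemma contraction_rate_tendsto_0: "((\<lambda>t. C * exp (- a * t)) \<longlongrightarrow> 0) at_top"
proof -
  have "LIM t at_top. - a * t :> at_bot"
    using a by (intro filterlim_tendsto_neg_mult_at_bot[OF tendsto_const _ filterlim_ident]) auto
  from tendsto_mult_right_zero[OF filterlim_compose[OF exp_at_bot this]]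
  show ?thesis by simp
qed

text \<open>Two bounded trajectories were at a bounded distance at time \<open>t - s\<close>, so they are
  exponentially close in \<open>s\<close> at time \<open>t\<close>; let \<open>s\<close> tend to infinity.\<close>

lemma bounded_complete_trajectory_unique:
  assumes "complete_trajectory \<theta> \<psi> q v" "complete_trajectory \<theta> \<psi> q w"
    and "bounded (range v)" "bounded (range w)"
  shows "v = w"
proof
  fix t
  obtain B C where B: "\<And>s. norm (v s) \<le> B" and C: "\<And>s. norm (w s) \<le> C"
    using assms(3,4) by (auto simp: bounded_iff)
  have le: "norm (v t - w t) \<le> (M * (B + C)) * exp (- a * s)" if s: "s \<ge> 0" for s
  proof -
    have *: "v t = \<psi> s (\<theta> (t - s) q) (v (t - s))" "w t = \<psi> s (\<theta> (t - s) q) (w (t - s))"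
      using assms(1,2) s unfolding complete_trajectory_def
      by (metis add.commute diff_add_cancel)+
    have "norm (v t - w t) \<le> M * exp (- a * s) * norm (v (t - s) - w (t - s))"
      unfolding * by (rule contraction[OF s])
    also have "\<dots> \<le> M * exp (- a * s) * (B + C)"
      using M by (intro mult_left_mono order_trans[OF norm_triangle_ineq4] add_mono B C) auto
    finally show ?thesis by (simp add: mult_ac)
  qed
  have "norm (v t - w t) \<le> 0"
    by (rule tendsto_lowerbound[OF contraction_rate_tendsto_0[of "M * (B + C)"]])
      (use le in \<open>auto intro: eventually_mono[OF eventually_ge_at_top[of 0]]\<close>)
  then show "v t = w t" by simp
qed

text \<open>
  Starting from \<open>x\<^sub>0\<close> further in the past, at \<open>-S\<close> instead of \<open>-T\<close>, replaces the state \<open>x\<^sub>0\<close> at time \<open>-T\<close>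
  by another one within distance \<open>R\<close>, which at time zero makes a difference of at most
  \<open>M R e\<^bsup>-aT\<^esup>\<close>. Hence the pullbacks converge uniformly on the base, which gives both the continuity
  of the limit and, since the time shift is absorbed by the limit, its invariance.
\<close>

lemma pullback_section:
  assumes bdd: "\<And>q t. t \<ge> 0 \<Longrightarrow> norm (\<psi> t q x0 - x0) \<le> R"
  shows "\<exists>\<Phi>. continuous_on UNIV \<Phi> \<and> (\<forall>q. \<forall>t\<ge>0. \<Phi> (\<theta> t q) = \<psi> t q (\<Phi> q))"
proof -
  define \<Phi>\<^sub>T where "\<Phi>\<^sub>T T q = \<psi> T (\<theta> (- T) q) x0" for T q
  have pull: "\<Phi>\<^sub>T (t + T) (\<theta> t q) = \<psi> t q (\<Phi>\<^sub>T T q)" if "t \<ge> 0" "T \<ge> 0" for t T q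
  proof -
    have "\<theta> (- (t + T)) (\<theta> t q) = \<theta> (- T) q" "\<theta> T (\<theta> (- T) q) = q"
      using flow_add[of "- (t + T)" t q] flow_add[of T "- T" q] flow_0 by simp_all
    then show ?thesis using cocycle_add[OF that] by (simp add: \<Phi>\<^sub>T_def)
  qed
  have cauchy: "norm (\<Phi>\<^sub>T S q - \<Phi>\<^sub>T T q) \<le> M * R * exp (- a * T)" if T: "0 \<le> T" "T \<le> S" for S T q
  proof -
    have "\<Phi>\<^sub>T S q = \<Phi>\<^sub>T (T + (S - T)) (\<theta> T (\<theta> (- T) q))"
      using flow_add[of T "- T" q] flow_0 by simp
    also have "\<dots> = \<psi> T (\<theta> (- T) q) (\<Phi>\<^sub>T (S - T) (\<theta> (- T) q))" using T by (intro pull) auto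
    finally have "norm (\<Phi>\<^sub>T S q - \<Phi>\<^sub>T T q)
        \<le> M * exp (- a * T) * norm (\<Phi>\<^sub>T (S - T) (\<theta> (- T) q) - x0)"
      using contraction[OF T(1)] by (simp only: \<Phi>\<^sub>T_def[of T])
    also have "\<dots> \<le> M * exp (- a * T) * R"
      using M T unfolding \<Phi>\<^sub>T_def by (intro mult_left_mono bdd) auto
    finally show ?thesis by (simp add: mult_ac)
  qed
  have "\<exists>l. (\<lambda>n. \<Phi>\<^sub>T (real n) q) \<longlonglongrightarrow> l" for q
  proof -
    have "Cauchy (\<lambda>n::nat. \<Phi>\<^sub>T (real n) q)"
    proof (rule CauchyI')
      fix e :: real assume "e > 0"
      then have "\<forall>\<^sub>F T in at_top. M * R * exp (- a * T) < e"
        using order_tendstoD(2)[OF contraction_rate_tendsto_0] by blast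
      then obtain T where T: "\<And>t. t \<ge> T \<Longrightarrow> M * R * exp (- a * t) < e"
        by (auto simp: eventually_at_top_linorder)
      obtain N :: nat where N: "T \<le> real N" using real_arch_simple by blast
      have "norm (\<Phi>\<^sub>T (real m) q - \<Phi>\<^sub>T (real n) q) < e" if "N \<le> m" "m < n" for m n
      proof -
        have "norm (\<Phi>\<^sub>T (real n) q - \<Phi>\<^sub>T (real m) q) \<le> M * R * exp (- a * real m)"
          using that(2) by (intro cauchy) auto
        moreover have "M * R * exp (- a * real m) < e"
          using N that(1) by (intro T) linarith
        ultimately show ?thesis by (simp add: norm_minus_commute)
      qed
      then show "\<exists>N. \<forall>m\<ge>N. \<forall>n>m. dist (\<Phi>\<^sub>T (real m) q) (\<Phi>\<^sub>T (real n) q) < e"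
        unfolding dist_norm by blast
    qed
    then show ?thesis using Cauchy_convergent convergent_def by blast
  qed
  then obtain \<Phi> where lim: "\<And>q. (\<lambda>n. \<Phi>\<^sub>T (real n) q) \<longlonglongrightarrow> \<Phi> q" by metis
  have rate: "norm (\<Phi> q - \<Phi>\<^sub>T T q) \<le> M * R * exp (- a * T)" if "T \<ge> 0" for T q
  proof (rule tendsto_upperbound[OF tendsto_norm[OF tendsto_diff[OF lim tendsto_const]]])
    show "\<forall>\<^sub>F n in sequentially. norm (\<Phi>\<^sub>T (real n) q - \<Phi>\<^sub>T T q) \<le> M * R * exp (- a * T)"
      using eventually_ge_at_top[of "nat \<lceil>T\<rceil>"]
    proof (rule eventually_mono)
      fix n assume "nat \<lceil>T\<rceil> \<le> n"
      then have "T \<le> real n" by linarith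
      with that show "norm (\<Phi>\<^sub>T (real n) q - \<Phi>\<^sub>T T q) \<le> M * R * exp (- a * T)" by (rule cauchy)
    qed
  qed simp
  have unif: "uniform_limit UNIV \<Phi>\<^sub>T \<Phi> at_top"
  proof (rule uniform_limitI)
    fix e :: real assume "e > 0"
    then have "\<forall>\<^sub>F T in at_top. M * R * exp (- a * T) < e"
      using order_tendstoD(2)[OF contraction_rate_tendsto_0] by blast
    then show "\<forall>\<^sub>F T in at_top. \<forall>q\<in>UNIV. dist (\<Phi>\<^sub>T T q) (\<Phi> q) < e"
      using eventually_ge_at_top[of 0]
    proof eventually_elim
      case (elim T)
      then show ?case using rate[OF elim(2)]
        by (auto simp: dist_norm norm_minus_commute intro: order.strict_trans1)
    qed
  qed
  have "\<forall>\<^sub>F T in at_top. continuous_on UNIV (\<Phi>\<^sub>T T)"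
    using eventually_ge_at_top[of 0] unfolding \<Phi>\<^sub>T_def
    by eventually_elim (intro cocycle_continuous[OF coc] flow_continuous[OF flow] continuous_intros, auto)
  from uniform_limit_theorem[OF this unif] have cont: "continuous_on UNIV \<Phi>" by simp
  note lim = tendsto_uniform_limitI[OF unif UNIV_I]
  have "\<Phi> (\<theta> t q) = \<psi> t q (\<Phi> q)" if t: "t \<ge> 0" for t q
  proof -
    have "continuous_on UNIV (\<lambda>v. \<psi> t q v)"
      using t by (intro cocycle_continuous[OF coc] continuous_intros) auto
    from continuous_on_tendsto_compose[OF this lim]
    have "((\<lambda>T. \<psi> t q (\<Phi>\<^sub>T T q)) \<longlongrightarrow> \<psi> t q (\<Phi> q)) at_top" by simp
    moreover have "((\<lambda>T. \<Phi>\<^sub>T (t + T) (\<theta> t q)) \<longlongrightarrow> \<Phi> (\<theta> t q)) at_top"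
      by (rule filterlim_compose[OF lim])
        (rule filterlim_tendsto_add_at_top[OF tendsto_const filterlim_ident])
    then have "((\<lambda>T. \<psi> t q (\<Phi>\<^sub>T T q)) \<longlongrightarrow> \<Phi> (\<theta> t q)) at_top"
      by (rule Lim_transform_eventually)
        (auto intro: eventually_mono[OF eventually_ge_at_top[of 0]] pull t)
    ultimately show ?thesis using tendsto_unique trivial_limit_at_top_linorder by blast
  qed
  with cont show ?thesis by blast
qed

end

section \<open>Almost periodic trajectories from invariant sections\<close>

text \<open>A time that moves no point of the base by more than a modulus of uniform continuity of \<open>\<Phi>\<close>
  is an almost-period of every trajectory on the graph of \<open>\<Phi>\<close>.\<close>

lemma section_almost_periodic_trajectory:
  fixes \<theta> :: "real \<Rightarrow> 'q::metric_space \<Rightarrow> 'q" and \<Phi> :: "'q \<Rightarrow> 'e::real_normed_vector"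
  assumes Q: "compact (UNIV :: 'q set)" and flow: "is_flow \<theta>" and ap: "almost_periodic_flow \<theta>"
    and cont: "continuous_on UNIV \<Phi>" and inv: "\<And>q t. t \<ge> 0 \<Longrightarrow> \<Phi> (\<theta> t q) = \<psi> t q (\<Phi> q)"
  shows "almost_periodic_trajectory \<theta> \<psi> q (\<lambda>t. \<Phi> (\<theta> t q))"
proof -
  have c: "continuous_on UNIV (\<lambda>t. \<Phi> (\<theta> t q))"
    by (intro continuous_on_compose2[OF cont] flow_continuous[OF flow] continuous_intros) auto
  have add: "\<theta> (t + s) q = \<theta> t (\<theta> s q)" for t s using flow by (simp add: is_flow_def)
  have "relatively_dense {\<tau>. \<forall>t. norm (\<Phi> (\<theta> (t + \<tau>) q) - \<Phi> (\<theta> t q)) \<le> e}" if e: "e > 0" for e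
  proof -
    obtain d where d: "d > 0" "\<And>x y. dist y x < d \<Longrightarrow> dist (\<Phi> y) (\<Phi> x) < e"
      using uniformly_continuous_onE[OF compact_uniformly_continuous[OF cont Q] e]
      by (metis UNIV_I)
    have "{\<tau>. \<forall>q. dist (\<theta> \<tau> q) q < d}
        \<subseteq> {\<tau>. \<forall>t. norm (\<Phi> (\<theta> (t + \<tau>) q) - \<Phi> (\<theta> t q)) \<le> e}"
    proof safe
      fix \<tau> t assume *: "\<forall>q. dist (\<theta> \<tau> q) q < d"
      have "\<theta> (t + \<tau>) q = \<theta> \<tau> (\<theta> t q)" using add[of \<tau> t] by (simp only: add.commute)
      then have "dist (\<Phi> (\<theta> (t + \<tau>) q)) (\<Phi> (\<theta> t q)) < e" using d(2) * by simp
      then show "norm (\<Phi> (\<theta> (t + \<tau>) q) - \<Phi> (\<theta> t q)) \<le> e" by (simp add: dist_norm)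
    qed
    with almost_periodic_flow_returns[OF Q ap d(1)] show ?thesis
      by (rule relatively_dense_mono)
  qed
  with c have "bohr_almost_periodic (\<lambda>t. \<Phi> (\<theta> t q))" by (simp add: bohr_almost_periodic_def)
  moreover have "complete_trajectory \<theta> \<psi> q (\<lambda>t. \<Phi> (\<theta> t q))"
    unfolding complete_trajectory_def add by (intro conjI allI impI c inv)
  ultimately show ?thesis by (simp add: almost_periodic_trajectory_def)
qed

theorem theorem5p1p1:
  fixes \<theta> :: "real \<Rightarrow> 'q::metric_space \<Rightarrow> 'q"
    and \<psi> :: "real \<Rightarrow> 'q \<Rightarrow> 'e::banach \<Rightarrow> 'e"
    and scaleE :: "'k::real_or_complex \<Rightarrow> 'e \<Rightarrow> 'e"
    and scaleH :: "'k \<Rightarrow> 'h::banach \<Rightarrow> 'h"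
    and ipH :: "'h \<Rightarrow> 'h \<Rightarrow> 'k"
    and J :: "'e \<Rightarrow> 'h"
    and P :: "'q \<Rightarrow> 'e \<Rightarrow>\<^sub>L 'e \<Rightarrow>\<^sub>L 'k"
    and \<nu>\<^sub>0 :: "'q \<Rightarrow> real"
    and \<nu>_minus \<nu>_plus \<delta>\<^sub>P \<tau>\<^sub>P :: real
  assumes "compact (UNIV :: 'q set)"
    and "is_flow \<theta>" and "minimal_flow \<theta>" and "almost_periodic_flow \<theta>"
    and "scalar_normed_space scaleE"
    and "scalar_hilbert_space scaleH ipH"
    and "continuous_embedding scaleE scaleH J"
    and "cocycle \<theta> \<psi>"
    and "\<And>q. operator_to_dual scaleE (P q)"
    and "\<And>q. symmetric_operator (P q)"
    and "continuous_on UNIV P"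
    and "bounded (range P)"
    and "\<And>q v. v \<noteq> 0 \<Longrightarrow> quadratic_form (P q) v > 0"
    and "squeezing_property \<theta> \<psi> J P \<nu>\<^sub>0 \<nu>_minus \<nu>_plus \<delta>\<^sub>P \<tau>\<^sub>P"
    and "continuous_on UNIV \<nu>\<^sub>0"
    and "\<nu>_minus > 0"
    and "asymptotically_compact \<psi> \<nu>_plus"
    and "uniform_lipschitz_property \<psi> J"
    and "\<exists>q\<^sub>0 v\<^sub>0 K. compact K \<and> (\<forall>t\<ge>0. \<psi> t q\<^sub>0 v\<^sub>0 \<in> K)"
  shows "(\<forall>q. \<exists>!v. almost_periodic_trajectory \<theta> \<psi> q v) \<and>
    (\<exists>v_star. (\<forall>q. almost_periodic_trajectory \<theta> \<psi> q (v_star q)) \<and>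
       continuous_on UNIV (\<lambda>q. v_star q 0) \<and>
       (\<exists>M>0. \<forall>v\<^sub>0 q. \<forall>t\<ge>0.
          norm (\<psi> t q v\<^sub>0 - \<psi> t q (v_star q 0))
            \<le> M * exp (- cumulative_exponent \<theta> \<nu>\<^sub>0 t q) * norm (v\<^sub>0 - v_star q 0)))"
proof -
  note Q = assms(1) and flow = assms(2) and coc = assms(8)
  have J: "bounded_linear J" using assms(7) by (simp add: continuous_embedding_def)
  have V: "quadratic_form (P q) v \<ge> 0" for q v
    using less_imp_le[OF assms(13)] by (cases "v = 0") (simp_all add: quadratic_form_zero)
  obtain M where M: "M > 0" and stable: "\<And>q v1 v2 t. t \<ge> 0 \<Longrightarrow> norm (\<psi> t q v1 - \<psi> t q v2)
           \<le> M * exp (- cumulative_exponent \<theta> \<nu>\<^sub>0 t q) * norm (v1 - v2)"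
    using squeezing_contraction[OF flow coc J assms(12) V assms(14,15,18)] by blast
  have \<nu>: "\<And>q. \<nu>_minus \<le> \<nu>\<^sub>0 q" "\<And>q. \<nu>\<^sub>0 q \<le> \<nu>_plus"
    using assms(14) by (auto simp: squeezing_property_def)
  interpret contracting_cocycle \<theta> \<psi> M \<nu>_minus
  proof
    fix t q and v1 v2 :: 'e assume t: "(0::real) \<le> t"
    have "\<nu>_minus * t \<le> cumulative_exponent \<theta> \<nu>\<^sub>0 t q"
      using cumulative_exponent_increment(1)[OF flow assms(15) \<nu> order_refl t, of q]
      by (simp add: cumulative_exponent_def)
    then have "M * exp (- cumulative_exponent \<theta> \<nu>\<^sub>0 t q) * norm (v1 - v2)
        \<le> M * exp (- \<nu>_minus * t) * norm (v1 - v2)"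
      using M by (intro mult_right_mono mult_left_mono) auto
    with stable[OF t] show "norm (\<psi> t q v1 - \<psi> t q v2) \<le> M * exp (- \<nu>_minus * t) * norm (v1 - v2)"
      by (rule order_trans)
  qed (use flow coc assms(16) M in auto)
  obtain q\<^sub>0 v\<^sub>0 K where K: "compact K" "\<And>t. t \<ge> 0 \<Longrightarrow> \<psi> t q\<^sub>0 v\<^sub>0 \<in> K" using assms(19) by blast
  define D where "D = diameter K"
  have D: "norm (x - y) \<le> D" if "x \<in> K" "y \<in> K" for x y
    using diameter_bounded_bound[OF compact_imp_bounded[OF K(1)] that]
    by (simp add: D_def dist_norm)
  have v0: "v\<^sub>0 \<in> K" using K(2)[of 0] coc by (simp add: cocycle_def)
  \<comment> \<open>The orbit of \<open>v\<^sub>0\<close> over \<open>q\<close> need not stay in \<open>K\<close>, but some orbit over \<open>q\<close> does, and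
      contraction keeps the two within \<open>M D\<close> of each other.\<close>
  have "norm (\<psi> t q v\<^sub>0 - v\<^sub>0) \<le> M * D + D" if t: "t \<ge> 0" for q t
  proof -
    obtain x where x: "x \<in> K" "\<And>t. t \<ge> 0 \<Longrightarrow> \<psi> t q x \<in> K"
      using precompact_orbit_over_every_point[OF coc
          forward_orbit_dense[OF Q flow assms(3,4)] K] by blast
    have "norm (\<psi> t q v\<^sub>0 - \<psi> t q x) \<le> M * exp (- \<nu>_minus * t) * norm (v\<^sub>0 - x)"
      by (rule contraction[OF t])
    also have "\<dots> \<le> M * 1 * D"
      using M a t D[OF v0 x(1)] by (intro mult_mono) auto
    finally show ?thesis
      using D[OF x(2)[OF t] v0] norm_triangle_ineq[of "\<psi> t q v\<^sub>0 - \<psi> t q x" "\<psi> t q x - v\<^sub>0"]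
      by simp
  qed
  from pullback_section[OF this] obtain \<Phi> where \<Phi>: "continuous_on UNIV \<Phi>"
    "\<And>q t. t \<ge> 0 \<Longrightarrow> \<Phi> (\<theta> t q) = \<psi> t q (\<Phi> q)" by blast
  let ?v = "\<lambda>q t. \<Phi> (\<theta> t q)"
  have ap: "almost_periodic_trajectory \<theta> \<psi> q (?v q)" for q
    using Q flow assms(4) \<Phi> by (rule section_almost_periodic_trajectory)
  have "w = ?v q" if "almost_periodic_trajectory \<theta> \<psi> q w" for q w
    using that ap[of q] unfolding almost_periodic_trajectory_def
    by (blast intro: bounded_complete_trajectory_unique bohr_almost_periodic_imp_bounded)
  with ap have "\<forall>q. \<exists>!v. almost_periodic_trajectory \<theta> \<psi> q v" by blast
  moreover have "continuous_on UNIV (\<lambda>q. ?v q 0)" using \<Phi>(1) by (simp add: flow_0)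
  ultimately show ?thesis
    using ap M stable by (intro conjI exI[of _ ?v] exI[of _ M] allI impI) auto
qed

end
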